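(* Let the field $\mathbb K$ have characteristic $0$. Suppose that a finite digraph $G=(V,E)$ without loops has a vertex $a$ such that there is only one outcoming edge $a\to b$ from $a$ and only one incoming edge $c\to a$, where $b\ne c$. Consider the digraph $G'=(V',E')$ where $V'=V\setminus\{a\}$ and $E'=E\setminus\{ab,ca\}$. Then the following is true. (a) For any $p\ge2$, $\dim H_p(G)=\dim H_p(G')$. (b) If $cb$ is an edge or a semi-edge in $G'$ then $\dim H_p(G)=\dim H_p(G')$ also for $p=0,1$, that is, for all $p\ge0$. (c) If $cb$ is neither an edge nor a semi-edge in $G'$, but $b,c$ belong to the same connected component of $G'$, then $\dim H_1(G)=\dim H_1(G')+1$ and $\dim H_0(G)=\dim H_0(G')$. (d) If $b,c$ belong to different connected components of $G'$ then $\dim H_1(G)=\dim H_1(G')$ and $\dim H_0(G)=\dim H_0(G')-1$. Consequently, in the case (b), $\chi(G)=\chi(G')$, whereas in the cases (c) and (d), $\chi(G)=\chi(G')-1$.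
   Context: $\mathbb K$ is the coefficient field. A finite digraph $G=(V,E)$ consists of a finite vertex set $V$ and $E\subset V\times V$; write $i\to j$ (edge $ij$) if $(i,j)\in E$. No loops: never $i\to i$. A pair $cb$ of distinct vertices is a semi-edge if $cb$ is not an edge but there is a vertex $j$ such that $cj$ and $jb$ are edges. Connected components are those of the underlying undirected graph. For $p\ge 0$, an elementary $p$-path is a sequence $i_0\dots i_p$ of vertices; it is regular if $i_{k-1}\ne i_k$ for all $k$. $\mathcal R_p$ is the $\mathbb K$-vector space with basis $\{e_{i_0\dots i_p}: i_0\dots i_p\text{ regular}\}$. The regular boundary operator $\partial:\mathcal R_p\to\mathcal R_{p-1}$, $p\ge1$, is $\partial e_{i_0\dots i_p}=\sum_{q=0}^p(-1)^qe_{i_0\dots\widehat{i_q}\dots i_p}$, with every term indexed by a non-regular sequence replaced by $0$; $\partial=0$ on $\mathcal R_0$. An elementary path $i_0\dots i_p$ is allowed if $i_{k-1}\to i_k$ for all $k=1,\dots,p$. $\mathcal A_p$ is the span of $e_{i_0\dots i_p}$ over allowed $p$-paths, $\mathcal A_{-1}=\{0\}$, and $\Omega_p=\{v\in\mathcal A_p:\partial v\in\mathcal A_{p-1}\}$. The path homologies $H_p(G)$, $p\ge0$, are the homologies of the chain complex $0\leftarrow\Omega_0\leftarrow\Omega_1\leftarrow\cdots$ with differential $\partial$. The Euler characteristic is $\chi(G)=\sum_{p\ge 0}(-1)^p\dim H_p(G)$, defined only when $H_p(G)=0$ for all large $p$; the statements on $\chi$ refer to the case when it is defined. *)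

theory Defs
  imports
    "Graph_Theory.Graph_Theory"
    "Jordan_Normal_Form.VS_Connect"
    "HOL-Library.Poly_Mapping"
begin

section \<open>Digraphs\<close>

text \<open>
  A finite digraph without loops is a \<^term>\<open>G\<close> with \<^prop>\<open>pair_digraph G\<close>.
\<close>

definition edge :: "'v pair_pre_digraph \<Rightarrow> 'v \<Rightarrow> 'v \<Rightarrow> bool" where
  "edge G i j \<longleftrightarrow> (i, j) \<in> parcs G"

definition semi_edge :: "'v pair_pre_digraph \<Rightarrow> 'v \<Rightarrow> 'v \<Rightarrow> bool" where
  "semi_edge G i k \<longleftrightarrow>
     i \<in> pverts G \<and> k \<in> pverts G \<and> i \<noteq> k \<and> \<not> edge G i k \<and>
     (\<exists>j \<in> pverts G. edge G i j \<and> edge G j k)"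

text \<open>
  Strong components of the symmetrised digraph are the connected components of the underlying
  undirected graph.
\<close>

definition connected_components :: "'v pair_pre_digraph \<Rightarrow> 'v set set" where
  "connected_components G = pre_digraph.sccs_verts (with_proj (mk_symmetric (with_proj G)))"

definition same_component :: "'v pair_pre_digraph \<Rightarrow> 'v \<Rightarrow> 'v \<Rightarrow> bool" where
  "same_component G u v \<longleftrightarrow> (\<exists>C \<in> connected_components G. u \<in> C \<and> v \<in> C)"

section \<open>Chains of elementary paths\<close>

text \<open>
  An elementary \<open>p\<close>-path is a list of length \<open>p + 1\<close>; chains are finitely supported functions on
  lists, with \<open>e\<^sub>w = Poly_Mapping.single w 1\<close>.
\<close>

type_synonym ('v, 'k) chain = "'v list \<Rightarrow>\<^sub>0 'k"

definition chain_scale :: "'k::field \<Rightarrow> ('v, 'k) chain \<Rightarrow> ('v, 'k) chain" where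
  "chain_scale r v = Poly_Mapping.map ((*) r) v"

lemma lookup_chain_scale [simp]:
  "Poly_Mapping.lookup (chain_scale r v) w = r * Poly_Mapping.lookup v w"
  by (simp add: chain_scale_def map.rep_eq when_def)

interpretation chain: vector_space "chain_scale :: 'k::field \<Rightarrow> ('v, 'k) chain \<Rightarrow> ('v, 'k) chain"
  by unfold_locales (rule poly_mapping_eqI, simp add: lookup_add algebra_simps)+

definition elem :: "'v list \<Rightarrow> ('v, 'k::field) chain" where
  "elem w = Poly_Mapping.single w 1"

definition regular :: "'v list \<Rightarrow> bool" where
  "regular w \<longleftrightarrow> successively (\<noteq>) w"

definition omit :: "nat \<Rightarrow> 'v list \<Rightarrow> 'v list" where
  "omit q w = take q w @ drop (Suc q) w"

text \<open>
  The formula for the boundary is linearly extended to all chains. It is the regular boundary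
  operator only on combinations of regular paths, which include all allowed paths of a digraph
  without loops.
\<close>

definition elem_boundary :: "'v list \<Rightarrow> ('v, 'k::field) chain" where
  "elem_boundary w =
     (if length w \<le> 1 then 0
      else \<Sum>q<length w. chain_scale ((-1) ^ q) (if regular (omit q w) then elem (omit q w) else 0))"

definition boundary :: "('v, 'k::field) chain \<Rightarrow> ('v, 'k) chain" where
  "boundary v = (\<Sum>w\<in>Poly_Mapping.keys v. chain_scale (Poly_Mapping.lookup v w) (elem_boundary w))"

section \<open>Path homology\<close>

definition allowed_paths :: "'v pair_pre_digraph \<Rightarrow> nat \<Rightarrow> 'v list set" where
  "allowed_paths G p =
     {w. length w = Suc p \<and> set w \<subseteq> pverts G \<and> successively (edge G) w}"

definition allowed_chains :: "'v pair_pre_digraph \<Rightarrow> nat \<Rightarrow> ('v, 'k::field) chain set" where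
  "allowed_chains G p = chain.span (elem ` allowed_paths G p)"

definition Omega :: "'v pair_pre_digraph \<Rightarrow> nat \<Rightarrow> ('v, 'k::field) chain set" where
  "Omega G p =
     {v \<in> allowed_chains G p. boundary v \<in> (case p of 0 \<Rightarrow> {0} | Suc q \<Rightarrow> allowed_chains G q)}"

definition cycles :: "'v pair_pre_digraph \<Rightarrow> nat \<Rightarrow> ('v, 'k::field) chain set" where
  "cycles G p = {v \<in> Omega G p. boundary v = 0}"

definition boundaries :: "'v pair_pre_digraph \<Rightarrow> nat \<Rightarrow> ('v, 'k::field) chain set" where
  "boundaries G p = boundary ` Omega G (Suc p)"

text \<open>
  The quotient vector space \<open>Z / B\<close>, with cosets as elements. The fields \<open>mult\<close> and \<open>one\<close> of the
  record play no role for a module. Adding \<open>B\<close> in the scalar multiplication only matters for the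
  scalar \<open>0\<close>.
\<close>

definition quotient_space ::
  "('k \<Rightarrow> 'c \<Rightarrow> 'c) \<Rightarrow> 'c::ab_group_add set \<Rightarrow> 'c set \<Rightarrow> ('k, 'c set) module" where
  "quotient_space scale Z B =
     \<lparr> carrier = (\<lambda>z. {z + b | b. b \<in> B}) ` Z,
       mult = undefined, one = undefined,
       zero = B,
       add = (\<lambda>X Y. {x + y | x y. x \<in> X \<and> y \<in> Y}),
       smult = (\<lambda>r X. {scale r x + b | x b. x \<in> X \<and> b \<in> B}) \<rparr>"

lemma (in vector_space) vectorspace_quotient_space:
  assumes Z: "subspace Z" and B: "subspace B"
  shows "vectorspace (class_ring :: 'a ring) (quotient_space scale Z B)"
proof -
  let ?Q = "quotient_space scale Z B"
  define c where "c = (\<lambda>z. {z + b | b. b \<in> B})"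
  have in_c: "u \<in> c z \<longleftrightarrow> u - z \<in> B" for u z
  proof
    assume "u - z \<in> B"
    moreover have "u = z + (u - z)" by simp
    ultimately show "u \<in> c z" unfolding c_def by blast
  qed (auto simp: c_def)
  note Bs = subspace_0[OF B] subspace_add[OF B] subspace_diff[OF B] subspace_scale[OF B]
  have zero: "zero ?Q = c 0" by (auto simp: quotient_space_def in_c)
  have carr: "carrier ?Q = c ` Z" by (simp add: quotient_space_def c_def)
  have addQ: "add ?Q X Y = {x + y | x y. x \<in> X \<and> y \<in> Y}" for X Y
    by (simp add: quotient_space_def)
  have smultQ: "smult ?Q r X = {scale r x + b | x b. x \<in> X \<and> b \<in> B}" for r X
    by (simp add: quotient_space_def)
  have add: "add ?Q (c x) (c y) = c (x + y)" for x y
  proof (intro equalityI subsetI)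
    fix u assume "u \<in> add ?Q (c x) (c y)"
    then obtain v w where *: "v - x \<in> B" "w - y \<in> B" "u = v + w"
      by (auto simp: addQ in_c)
    then show "u \<in> c (x + y)" using Bs(2)[OF *(1,2)] by (simp add: in_c algebra_simps)
  next
    fix u assume "u \<in> c (x + y)"
    then have "u - y \<in> c x" "y \<in> c y" "u = (u - y) + y"
      using Bs(1) by (auto simp: in_c algebra_simps)
    then show "u \<in> add ?Q (c x) (c y)" unfolding addQ by blast
  qed
  have smult: "smult ?Q r (c x) = c (scale r x)" for r x
  proof (intro equalityI subsetI)
    fix u assume "u \<in> smult ?Q r (c x)"
    then obtain v b where *: "v - x \<in> B" "b \<in> B" "u = scale r v + b"
      by (auto simp: smultQ in_c)
    then show "u \<in> c (scale r x)"
      using Bs(2)[OF Bs(4)[OF *(1), of r] *(2)] by (simp add: in_c algebra_simps)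
  next
    fix u assume "u \<in> c (scale r x)"
    then have "x \<in> c x" "u - scale r x \<in> B" "u = scale r x + (u - scale r x)"
      using Bs(1) by (auto simp: in_c)
    then show "u \<in> smult ?Q r (c x)" unfolding smultQ by blast
  qed
  have Zs: "0 \<in> Z" "x \<in> Z \<Longrightarrow> y \<in> Z \<Longrightarrow> x + y \<in> Z" "x \<in> Z \<Longrightarrow> scale r x \<in> Z" "x \<in> Z \<Longrightarrow> - x \<in> Z"
    for x y r
    using subspace_0[OF Z] subspace_add[OF Z] subspace_scale[OF Z] subspace_neg[OF Z] by auto
  have K: "cring (class_ring :: 'a ring)" using class_field[where 'a='a] by (simp add: field_def domain_def)
  have group: "abelian_group ?Q"
  proof (rule abelian_groupI)
    fix X assume "X \<in> carrier ?Q"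
    then obtain x where x: "x \<in> Z" "X = c x" unfolding carr by blast
    have "add ?Q (c (- x)) X = zero ?Q" unfolding x(2) add zero by simp
    then show "\<exists>Y\<in>carrier ?Q. add ?Q Y X = zero ?Q" using Zs(4)[OF x(1)] unfolding carr by blast
  qed (auto simp: carr zero add Zs ac_simps intro!: imageI)
  have "module (class_ring :: 'a ring) ?Q"
    by (rule moduleI[OF K group])
      (auto simp: carr smult add Zs scale_left_distrib scale_right_distrib intro!: imageI)
  then show ?thesis by (intro vectorspace.intro class_field)
qed

definition path_homology ::
  "'v pair_pre_digraph \<Rightarrow> nat \<Rightarrow> ('k::field, ('v, 'k) chain set) module" where
  "path_homology G p = quotient_space chain_scale (cycles G p) (boundaries G p)"

definition dim_H :: "'k::field itself \<Rightarrow> 'v pair_pre_digraph \<Rightarrow> nat \<Rightarrow> nat" where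
  "dim_H K G p =
     vectorspace.dim (class_ring :: 'k ring) (path_homology G p :: ('k, ('v, 'k) chain set) module)"

definition euler_char_defined :: "'k::field itself \<Rightarrow> 'v pair_pre_digraph \<Rightarrow> bool" where
  "euler_char_defined K G \<longleftrightarrow>
     (\<exists>N. \<forall>p\<ge>N. carrier (path_homology G p :: ('k, ('v, 'k) chain set) module) =
                 {\<zero>\<^bsub>(path_homology G p :: ('k, ('v, 'k) chain set) module)\<^esub>})"

text \<open>
  The sum is over the support of the Betti numbers, which is finite if \<^const>\<open>euler_char_defined\<close>
  holds; otherwise the value is meaningless.
\<close>

definition euler_char :: "'k::field itself \<Rightarrow> 'v pair_pre_digraph \<Rightarrow> int" where
  "euler_char K G = (\<Sum>p | dim_H K G p \<noteq> 0. (-1) ^ p * int (dim_H K G p))"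

end

theory Submission
  imports Defs
begin

text \<open>
  Write \<open>H\<close> for the digraph without \<open>a\<close>, called \<open>G'\<close> in the theorem. The idea is that hardly any
  path through \<open>a\<close> can occur in a \<open>\<partial>\<close>-invariant chain. Suppose that \<open>x \<noteq> y\<close>, that \<open>xy\<close> is not an
  edge, and that \<open>m\<close> is the only vertex with \<open>x \<rightarrow> m \<rightarrow> y\<close>. If a path \<open>\<dots>xmy\<dots>\<close> occurs in an
  allowed chain \<open>v\<close>, then omitting \<open>m\<close> gives a path that is not allowed and that arises from no other
  path in \<open>v\<close>; it does not cancel in \<open>\<partial>v\<close>, so \<open>v\<close> is not in \<open>\<Omega>\<close>
  (\<open>coeff_Omega_unique_filler\<close>). As \<open>c\<close> is the only predecessor and \<open>b\<close> the only successor of \<open>a\<close>,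
  this applies to \<open>xca\<close> and to \<open>aby\<close>. Hence the only path through \<open>a\<close> with at least three vertices
  that can occur is \<open>cab\<close> (\<open>Omega_through_a\<close>), and \<open>\<Omega>\<^sub>p(G) = \<Omega>\<^sub>p(H)\<close> for \<open>p \<ge> 3\<close>. The coefficient
  of \<open>ab\<close> in \<open>\<partial>v\<close> is that of \<open>cab\<close> in \<open>v\<close>, so \<open>cab\<close> does not occur in 2-cycles. Therefore cycles and
  boundaries of \<open>G\<close> and \<open>H\<close> coincide in degrees \<open>p \<ge> 2\<close>, and so do the homologies.

  In degrees 0 and 1 the dimension of homology is that of the cycles \<open>Z\<close> minus that of the boundaries
  \<open>B\<close>, and each of these four spaces for \<open>G\<close> arises from the one for \<open>H\<close> by adjoining very few chains:
  \<^item> \<open>Z\<^sub>0\<close> gains \<open>a\<close>;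
  \<^item> \<open>B\<^sub>0\<close> gains \<open>a - c\<close> and \<open>b - c\<close>, but \<open>b - c\<close> is already a boundary of \<open>H\<close> exactly if \<open>b\<close>
    and \<open>c\<close> are in the same component (\<open>same_component_iff_homologous\<close>);
  \<^item> \<open>Z\<^sub>1\<close> gains a cycle that passes through \<open>ca + ab\<close> and returns from \<open>b\<close> to \<open>c\<close> in \<open>H\<close>, exactly if
    \<open>b - c\<close> is a boundary of \<open>H\<close>;
  \<^item> \<open>B\<^sub>1\<close> gains the boundary of a chain with \<open>cab\<close> in it, namely of \<open>cab\<close> if \<open>cb\<close> is an edge and of
    \<open>cab - cjb\<close> if \<open>c \<rightarrow> j \<rightarrow> b\<close>. If \<open>cb\<close> is neither an edge nor a semi-edge, then \<open>a\<close> is the only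
    vertex between \<open>c\<close> and \<open>b\<close>, and the first observation excludes \<open>cab\<close> as well.

  Comparing the four contributions gives all cases, and the Euler characteristics differ only by the
  terms of degree 0 and 1.
\<close>

section \<open>Dimensions of subspaces and quotients\<close>

context vector_space
begin

lemma dim_adjoin:
  assumes S: "subspace S" and fin: "S \<subseteq> span F" "finite F" and x: "x \<notin> S"
    and T: "T = {s + scale r x | s r. s \<in> S}"
  shows "dim T = dim S + 1"
proof -
  obtain D where D: "D \<subseteq> S" "independent D" "S \<subseteq> span D" "card D = dim S"
    by (rule basis_exists)
  have spanD: "span D = S"
    using D S by (simp add: span_subspace)
  have "finite D"
    using independent_span_bound[OF fin(2) D(2)] D(1) fin(1) by blast
  moreover have "x \<notin> D" using D(1) x by blast
  moreover have "independent (insert x D)"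
    using D(2) x spanD by (simp add: independent_insertI)
  moreover have "span (insert x D) = T"
  proof (intro equalityI subsetI)
    fix v assume "v \<in> span (insert x D)"
    then obtain r where "v - scale r x \<in> S"
      by (auto simp: span_insert spanD)
    moreover have "v = (v - scale r x) + scale r x" by simp
    ultimately show "v \<in> T" unfolding T by blast
  next
    fix v assume "v \<in> T"
    then obtain s r where "s \<in> S" "v = s + scale r x" by (auto simp: T)
    then have "v - scale r x \<in> S" by simp
    then show "v \<in> span (insert x D)" by (auto simp: span_insert spanD)
  qed
  ultimately show ?thesis
    using D(4) dim_span_eq_card_independent[of "insert x D"] by simp
qed

lemma dim_subset_fin:
  assumes "S \<subseteq> T" and "T \<subseteq> span F" and "finite F"
  shows "dim S \<le> dim T"
proof -
  obtain D where D: "D \<subseteq> T" "independent D" "T \<subseteq> span D" "card D = dim T"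
    by (rule basis_exists)
  have "finite D"
    using independent_span_bound[OF assms(3) D(2)] D(1) assms(2) by blast
  then show ?thesis
    using dim_le_card[of S D] D assms(1) by auto
qed

text \<open>
  A basis \<open>D\<close> of \<open>B\<close> is extended to a basis \<open>E\<close> of \<open>Z\<close>; the cosets of the vectors in \<open>E - D\<close> then form
  a basis of the quotient.
\<close>

lemma dim_quotient_space:
  assumes Z: "subspace Z" and B: "subspace B" and BZ: "B \<subseteq> Z"
    and fin: "Z \<subseteq> span F" "finite F"
  shows "vectorspace.dim (class_ring :: 'a ring) (quotient_space scale Z B) = dim Z - dim B"
proof -
  let ?Q = "quotient_space scale Z B"
  interpret Q: vectorspace "class_ring :: 'a ring" ?Q
    by (rule vectorspace_quotient_space[OF Z B])
  define c where "c = (\<lambda>z. {z + b | b. b \<in> B})"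
  have in_c: "u \<in> c z \<longleftrightarrow> u - z \<in> B" for u z
  proof
    assume "u - z \<in> B"
    moreover have "u = z + (u - z)" by simp
    ultimately show "u \<in> c z" unfolding c_def by blast
  qed (auto simp: c_def)
  note Bs = subspace_0[OF B] subspace_add[OF B] subspace_diff[OF B] subspace_scale[OF B]
  have c_eq: "c u = c z \<longleftrightarrow> u - z \<in> B" for u z
  proof
    assume "c u = c z"
    then have "u \<in> c z" using Bs(1) in_c[of u u] by simp
    then show "u - z \<in> B" by (simp add: in_c)
  next
    assume uz: "u - z \<in> B"
    have "w - u \<in> B \<longleftrightarrow> w - z \<in> B" for w
      using Bs(2)[OF _ uz, of "w - u"] Bs(3)[OF _ uz, of "w - z"] by auto
    then show "c u = c z" by (auto simp: in_c)
  qed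
  have zero: "zero ?Q = c 0" by (auto simp: quotient_space_def in_c)
  have carr: "carrier ?Q = c ` Z" by (simp add: quotient_space_def c_def)
  have addQ: "add ?Q X Y = {x + y | x y. x \<in> X \<and> y \<in> Y}" for X Y
    by (simp add: quotient_space_def)
  have smultQ: "smult ?Q r X = {scale r x + b | x b. x \<in> X \<and> b \<in> B}" for r X
    by (simp add: quotient_space_def)
  have add: "add ?Q (c x) (c y) = c (x + y)" for x y
  proof (intro equalityI subsetI)
    fix u assume "u \<in> add ?Q (c x) (c y)"
    then obtain v w where *: "v - x \<in> B" "w - y \<in> B" "u = v + w"
      by (auto simp: addQ in_c)
    then show "u \<in> c (x + y)" using Bs(2)[OF *(1,2)] by (simp add: in_c algebra_simps)
  next
    fix u assume "u \<in> c (x + y)"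
    then have "u - y \<in> c x" "y \<in> c y" "u = (u - y) + y"
      using Bs(1) by (auto simp: in_c algebra_simps)
    then show "u \<in> add ?Q (c x) (c y)" unfolding addQ by blast
  qed
  have smult: "smult ?Q r (c x) = c (scale r x)" for r x
  proof (intro equalityI subsetI)
    fix u assume "u \<in> smult ?Q r (c x)"
    then obtain v b where *: "v - x \<in> B" "b \<in> B" "u = scale r v + b"
      by (auto simp: smultQ in_c)
    then show "u \<in> c (scale r x)"
      using Bs(2)[OF Bs(4)[OF *(1), of r] *(2)] by (simp add: in_c algebra_simps)
  next
    fix u assume "u \<in> c (scale r x)"
    then have "x \<in> c x" "u - scale r x \<in> B" "u = scale r x + (u - scale r x)"
      using Bs(1) by (auto simp: in_c)
    then show "u \<in> smult ?Q r (c x)" unfolding smultQ by blast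
  qed
  obtain D where D: "D \<subseteq> B" "independent D" "B \<subseteq> span D" "card D = dim B"
    by (rule basis_exists)
  obtain E where E: "D \<subseteq> E" "E \<subseteq> Z" "independent E" "Z \<subseteq> span E"
    using maximal_independent_subset_extend[of D Z] D BZ by blast
  have finE: "finite E"
    using independent_span_bound[OF fin(2) E(3)] E(2) fin(1) by blast
  then have finD: "finite D" using E(1) finite_subset by blast
  have spanD: "span D = B" using D B by (simp add: span_subspace)
  define S where "S = E - D"
  have S: "finite S" "S \<subseteq> Z" using finE E by (auto simp: S_def)
  have sumE: "(\<Sum>e\<in>E. f e) = (\<Sum>e\<in>S. f e) + (\<Sum>e\<in>D. f e)" for f :: "'b \<Rightarrow> 'b"
    unfolding S_def using sum.subset_diff[OF E(1) finE] by blast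
  have inj: "inj_on c S"
  proof (rule inj_onI, rule ccontr)
    fix s t assume st: "s \<in> S" "t \<in> S" "c s = c t" "s \<noteq> t"
    then have "s - t \<in> span D" by (simp add: c_eq spanD)
    then have "s - scale 1 t \<in> span D" by simp
    then have "s \<in> span (insert t D)" unfolding span_insert by blast
    moreover have "insert t D \<subseteq> E - {s}" using st E(1) by (auto simp: S_def)
    ultimately have "s \<in> span (E - {s})" using span_mono by blast
    then show False using E(3) st(1) by (auto simp: dependent_def S_def)
  qed
  have indep: "f s = 0" if sumB: "(\<Sum>s\<in>S. scale (f s) s) \<in> B" and s: "s \<in> S" for f s
  proof -
    obtain g where g: "(\<Sum>s\<in>S. scale (f s) s) = (\<Sum>d\<in>D. scale (g d) d)"
      using sumB by (auto simp: spanD[symmetric] span_finite[OF finD])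
    define h where "h = (\<lambda>e. if e \<in> D then - g e else f e)"
    have "(\<Sum>s\<in>S. scale (h s) s) = (\<Sum>s\<in>S. scale (f s) s)"
      by (rule sum.cong) (auto simp: h_def S_def)
    moreover have "(\<Sum>d\<in>D. scale (h d) d) = - (\<Sum>d\<in>D. scale (g d) d)"
      by (simp add: h_def sum_negf)
    ultimately have "(\<Sum>e\<in>E. scale (h e) e) = 0"
      using g by (simp add: sumE)
    then have "h s = 0"
      using independentD[OF E(3) finE order_refl, of h s] s by (auto simp: S_def)
    then show ?thesis using s by (auto simp: h_def S_def)
  qed
  have finsum: "finsum ?Q (\<lambda>s. c (f s)) T = c (\<Sum>s\<in>T. f s)"
    if "finite T" "\<And>s. s \<in> T \<Longrightarrow> f s \<in> Z" for f :: "'b \<Rightarrow> 'b" and T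
    using that by (induction T rule: finite_induct) (auto simp: zero add carr)
  have lincomb: "Q.lincomb r (c ` S) = c (\<Sum>s\<in>S. scale (r (c s)) s)" for r
  proof -
    have "Q.lincomb r (c ` S) = finsum ?Q (\<lambda>s. smult ?Q (r (c s)) (c s)) S"
      unfolding Q.lincomb_def
      using S(2) by (intro Q.finsum_reindex[OF _ inj])
        (auto simp: smult carr intro!: imageI subspace_scale[OF Z])
    also have "\<dots> = c (\<Sum>s\<in>S. scale (r (c s)) s)"
      unfolding smult using S by (intro finsum) (auto intro: subspace_scale[OF Z])
    finally show ?thesis .
  qed
  have cS: "c ` S \<subseteq> carrier ?Q" "finite (c ` S)" using S by (auto simp: carr)
  have "Q.basis (c ` S)"
    unfolding Q.basis_def
  proof (intro conjI cS(1))
    show "\<not> Q.lin_dep (c ` S)"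
    proof (rule Q.finite_lin_indpt2[OF cS(2,1)])
      fix r assume "Q.lincomb r (c ` S) = \<zero>\<^bsub>?Q\<^esub>"
      then have "(\<Sum>s\<in>S. scale (r (c s)) s) \<in> B"
        by (simp add: lincomb zero c_eq)
      then show "\<forall>v\<in>c ` S. r v = \<zero>\<^bsub>class_ring\<^esub>" using indep[of "\<lambda>s. r (c s)"] by auto
    qed
    show "LinearCombinations.module.span class_ring ?Q (c ` S) = carrier ?Q"
    proof (intro equalityI subsetI)
      fix X assume "X \<in> LinearCombinations.module.span class_ring ?Q (c ` S)"
      then obtain r where "X = c (\<Sum>s\<in>S. scale (r (c s)) s)"
        by (auto simp: Q.finite_span[OF cS(2,1)] lincomb)
      then show "X \<in> carrier ?Q"
        unfolding carr using S(2) by (auto intro!: imageI subspace_sum[OF Z] subspace_scale[OF Z])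
    next
      fix X assume "X \<in> carrier ?Q"
      then obtain z where z: "z \<in> Z" "X = c z" by (auto simp: carr)
      then obtain f where f: "z = (\<Sum>e\<in>E. scale (f e) e)"
        using E(4) by (auto simp: span_finite[OF finE])
      (* The coefficients are indexed by the cosets and not by their representatives. *)
      define r where "r = (\<lambda>X. f (the_inv_into S c X))"
      have "(\<Sum>s\<in>S. scale (r (c s)) s) = (\<Sum>s\<in>S. scale (f s) s)"
        by (rule sum.cong) (auto simp: r_def the_inv_into_f_f[OF inj])
      moreover have "(\<Sum>d\<in>D. scale (f d) d) \<in> B"
        using D(1) by (intro subspace_sum[OF B] subspace_scale[OF B]) auto
      ultimately have "Q.lincomb r (c ` S) = X"
        unfolding z lincomb c_eq f sumE by (simp add: subspace_neg[OF B])
      then show "X \<in> LinearCombinations.module.span class_ring ?Q (c ` S)"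
        by (auto simp: Q.finite_span[OF cS(2,1)])
    qed
  qed
  then have "Q.dim = card (c ` S)" by (rule Q.dim_basis[OF cS(2)])
  also have "\<dots> = card S" by (rule card_image[OF inj])
  also have "\<dots> = card E - card D"
    unfolding S_def using finD E(1) by (rule card_Diff_subset)
  also have "card E = dim Z" using E(2-4) by (intro basis_card_eq_dim)
  finally show ?thesis using D(4) by simp
qed

end

section \<open>Chains and their boundaries\<close>

abbreviation coeff :: "('v, 'k::field) chain \<Rightarrow> 'v list \<Rightarrow> 'k" where
  "coeff \<equiv> Poly_Mapping.lookup"

lemma coeff_elem: "coeff (elem w) u = (if u = w then 1 else 0)"
  by (simp add: elem_def lookup_single when_def)

lemma coeff_sum: "coeff (\<Sum>i\<in>I. f i) w = (\<Sum>i\<in>I. coeff (f i) w)"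
  by (induction I rule: infinite_finite_induct) (auto simp: lookup_add)

lemma chain_eq_sum_elem:
  assumes "finite S" and "Poly_Mapping.keys v \<subseteq> S"
  shows "v = (\<Sum>w\<in>S. chain_scale (coeff v w) (elem w))"
proof (rule poly_mapping_eqI)
  fix u
  have "(\<Sum>w\<in>S. coeff v w * (if u = w then 1 else 0)) = (if u \<in> S then coeff v u else 0)"
    using assms(1) by (simp add: sum.delta' if_distrib[of "(*) _"] cong: if_cong)
  then show "coeff v u = coeff (\<Sum>w\<in>S. chain_scale (coeff v w) (elem w)) u"
    using assms(2) by (auto simp: coeff_sum coeff_elem in_keys_iff)
qed

lemma span_elem:
  "chain.span (elem ` S) = {v :: ('v, 'k::field) chain. Poly_Mapping.keys v \<subseteq> S}"
proof (intro equalityI subsetI)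
  have "chain.subspace {v :: ('v, 'k) chain. Poly_Mapping.keys v \<subseteq> S}"
    unfolding chain.subspace_def
  proof (intro conjI allI ballI)
    fix u v :: "('v, 'k) chain" assume "u \<in> {v. Poly_Mapping.keys v \<subseteq> S}" "v \<in> {v. Poly_Mapping.keys v \<subseteq> S}"
    then show "u + v \<in> {v. Poly_Mapping.keys v \<subseteq> S}"
      using Poly_Mapping.keys_add[of u v] by blast
  qed (auto simp: subset_iff in_keys_iff)
  moreover have "elem ` S \<subseteq> {v :: ('v, 'k) chain. Poly_Mapping.keys v \<subseteq> S}"
    by (auto simp: in_keys_iff coeff_elem split: if_splits)
  ultimately show "v \<in> {v. Poly_Mapping.keys v \<subseteq> S}" if "v \<in> chain.span (elem ` S)" for v :: "('v, 'k) chain"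
    using that chain.span_minimal by blast
next
  fix v :: "('v, 'k) chain" assume v: "v \<in> {v. Poly_Mapping.keys v \<subseteq> S}"
  have "(\<Sum>w\<in>Poly_Mapping.keys v. chain_scale (coeff v w) (elem w)) \<in> chain.span (elem ` S)"
    using v by (intro chain.span_sum chain.span_scale chain.span_base) auto
  then show "v \<in> chain.span (elem ` S)"
    using chain_eq_sum_elem[of "Poly_Mapping.keys v" v] by simp
qed

lemma boundary_eq_sum:
  assumes "finite S" and "Poly_Mapping.keys v \<subseteq> S"
  shows "boundary v = (\<Sum>w\<in>S. chain_scale (coeff v w) (elem_boundary w))"
  unfolding boundary_def using assms
  by (intro sum.mono_neutral_left) (auto simp: in_keys_iff)

interpretation boundary: Vector_Spaces.linear
  "chain_scale :: 'k::field \<Rightarrow> ('v, 'k) chain \<Rightarrow> ('v, 'k) chain" chain_scale boundary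
proof
  show "boundary (u + v) = boundary u + boundary v" for u v :: "('v, 'k) chain"
  proof -
    let ?S = "Poly_Mapping.keys u \<union> Poly_Mapping.keys v"
    have "Poly_Mapping.keys (u + v) \<subseteq> ?S" by (rule Poly_Mapping.keys_add)
    then show ?thesis
      by (simp add: boundary_eq_sum[of ?S] lookup_add chain.scale_left_distrib sum.distrib)
  qed
  show "boundary (chain_scale r v) = chain_scale r (boundary v)" for r and v :: "('v, 'k) chain"
  proof -
    have "Poly_Mapping.keys (chain_scale r v) \<subseteq> Poly_Mapping.keys v"
      by (auto simp: in_keys_iff)
    then show ?thesis
      by (simp add: boundary_eq_sum[of "Poly_Mapping.keys v"] chain.scale_sum_right)
  qed
qed

lemma boundary_elem: "boundary (elem w) = elem_boundary w"
  by (simp add: boundary_eq_sum[of "{w}"] coeff_elem in_keys_iff subset_iff)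

lemma coeff_elem_boundary:
  "coeff (elem_boundary w :: ('v, 'k::field) chain) u =
     (if length w \<le> 1 \<or> \<not> regular u then 0 else \<Sum>q | q < length w \<and> omit q w = u. (-1) ^ q)"
proof (cases "length w \<le> 1")
  case False
  have "coeff (elem_boundary w :: ('v, 'k) chain) u =
      (\<Sum>q<length w. if omit q w = u \<and> regular u then (-1) ^ q else 0)"
    using False by (auto simp: elem_boundary_def coeff_sum coeff_elem intro!: sum.cong)
  also have "\<dots> = (if regular u then (\<Sum>q | q < length w \<and> omit q w = u. (-1) ^ q) else 0)"
    by (auto simp: sum.inter_filter[symmetric] lessThan_def intro!: sum.cong)
  finally show ?thesis using False by (simp split: if_split)
qed (simp add: elem_boundary_def)

lemma coeff_boundary:
  "coeff (boundary v) u = (\<Sum>w\<in>Poly_Mapping.keys v. coeff v w * coeff (elem_boundary w) u)"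
  by (simp add: boundary_def coeff_sum)

lemma keys_boundaryE:
  fixes v :: "('v, 'k::field) chain"
  assumes "u \<in> Poly_Mapping.keys (boundary v)"
  obtains w q where "w \<in> Poly_Mapping.keys v" "q < length w" "u = omit q w"
proof -
  have "(\<Sum>w\<in>Poly_Mapping.keys v. coeff v w * coeff (elem_boundary w) u) \<noteq> 0"
    using assms by (simp add: in_keys_iff coeff_boundary)
  then obtain w where w: "w \<in> Poly_Mapping.keys v" "coeff (elem_boundary w :: ('v, 'k) chain) u \<noteq> 0"
    by (elim sum.not_neutral_contains_not_neutral) auto
  from w(2) have "\<exists>q<length w. omit q w = u"
    unfolding coeff_elem_boundary
    by (auto split: if_splits elim: sum.not_neutral_contains_not_neutral)
  with w(1) that show ?thesis by blast
qed

lemma set_omit: "set (omit q w) \<subseteq> set w"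
  unfolding omit_def using set_take_subset[of q w] set_drop_subset[of "Suc q" w] by auto

lemma elem_boundary_2: "elem_boundary [x, y] = elem [y] - elem [x]"
  by (simp add: elem_boundary_def omit_def regular_def lessThan_Suc numeral_2_eq_2)

lemma elem_boundary_3:
  assumes "x \<noteq> y" "y \<noteq> z"
  shows "elem_boundary [x, y, z] =
    elem [y, z] - (if x = z then 0 else elem [x, z]) + elem [x, y]"
  using assms by (simp add: elem_boundary_def omit_def regular_def lessThan_Suc numeral_3_eq_3)

lemma boundary_boundary_3:
  assumes "x \<noteq> y" "y \<noteq> z"
  shows "boundary (boundary (elem [x, y, z])) = 0"
  using assms by (simp add: boundary_elem elem_boundary_3 elem_boundary_2 boundary.add boundary.diff)

lemma allowed_chains_iff:
  "v \<in> allowed_chains G p \<longleftrightarrow> Poly_Mapping.keys v \<subseteq> allowed_paths G p"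
  by (simp add: allowed_chains_def span_elem)

lemma elem_in_allowed_chains: "elem w \<in> allowed_chains G p \<longleftrightarrow> w \<in> allowed_paths G p"
  by (auto simp: allowed_chains_iff in_keys_iff coeff_elem subset_iff)

lemma subspace_allowed_chains: "chain.subspace (allowed_chains G p)"
  by (simp add: allowed_chains_def)

lemma Omega_0: "Omega G 0 = allowed_chains G 0"
proof -
  have "boundary v = 0" if "v \<in> allowed_chains G 0" for v :: "('a, 'b) chain"
    unfolding boundary_def using that
    by (intro sum.neutral) (auto simp: allowed_chains_iff allowed_paths_def elem_boundary_def)
  then show ?thesis by (auto simp: Omega_def)
qed

lemma cycles_0: "cycles G 0 = Omega G 0"
  by (auto simp: cycles_def Omega_def)

lemma subspace_Omega: "chain.subspace (Omega G p)"
  by (cases p)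
    (auto simp: Omega_def chain.subspace_def boundary.add boundary.scale boundary.zero
       intro: chain.subspace_0 chain.subspace_add chain.subspace_scale subspace_allowed_chains)

lemma subspace_cycles: "chain.subspace (cycles G p)"
  using subspace_Omega[of G p]
  by (auto simp: cycles_def chain.subspace_def boundary.add boundary.scale boundary.zero)

lemma subspace_boundaries: "chain.subspace (boundaries G p)"
  unfolding boundaries_def by (intro boundary.subspace_image subspace_Omega)

lemma finite_allowed_paths:
  assumes "finite (pverts G)"
  shows "finite (allowed_paths G p)"
  by (rule finite_subset[OF _ finite_lists_length_eq[OF assms, of "Suc p"]])
    (auto simp: allowed_paths_def)

lemma boundaries_subset_allowed: "boundaries G p \<subseteq> allowed_chains G p"
  by (auto simp: boundaries_def Omega_def)

section \<open>Paths that cannot occur in invariant chains\<close>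

lemma coeff_boundary_single:
  assumes "\<And>w'. w' \<in> Poly_Mapping.keys v \<Longrightarrow> w' \<noteq> w \<Longrightarrow> u \<notin> {omit q w' | q. q < length w'}"
  shows "coeff (boundary v) u = coeff v w * coeff (elem_boundary w) u"
proof -
  have zero: "coeff (elem_boundary w' :: ('a, 'b) chain) u = 0"
    if "w' \<in> Poly_Mapping.keys v" "w' \<noteq> w" for w'
    using assms[OF that] by (auto simp: coeff_elem_boundary intro!: sum.neutral)
  have "coeff (boundary v) u = (\<Sum>w'\<in>insert w (Poly_Mapping.keys v). coeff v w' * coeff (elem_boundary w') u)"
    unfolding coeff_boundary by (rule sum.mono_neutral_left) (auto simp: in_keys_iff)
  also have "\<dots> = (\<Sum>w'\<in>{w}. coeff v w' * coeff (elem_boundary w') u)"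
    by (rule sum.mono_neutral_right) (auto simp: zero)
  finally show ?thesis by simp
qed

lemma nth_omit:
  assumes "q < length w" and "Suc i < length w"
  shows "omit q w ! i = (if i < q then w ! i else w ! Suc i)"
  using assms by (auto simp: omit_def nth_append min_def)

lemma allowed_path_edge:
  assumes "w \<in> allowed_paths G p" and "Suc i < length w"
  shows "edge G (w ! i) (w ! Suc i)"
  using assms by (auto simp: allowed_paths_def successively_conv_nth)

text \<open>
  Omitting \<open>m\<close> gives the path \<open>xs @ [x, y] @ ys\<close>, which is regular but not allowed, so its
  coefficient in \<open>boundary v\<close> is zero. An allowed path from which it arises by one omission must have
  the omitted vertex between \<open>x\<close> and \<open>y\<close>, since otherwise \<open>x\<close> and \<open>y\<close> would be adjacent in it. That
  vertex is \<open>m\<close>, so the path in question is the only one that contributes to this coefficient.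
\<close>

lemma coeff_Omega_unique_filler:
  assumes no_loop: "\<And>z. \<not> edge G z z"
    and xy: "x \<noteq> y" "\<not> edge G x y"
    and unique: "\<And>z. edge G x z \<Longrightarrow> edge G z y \<Longrightarrow> z = m"
    and v: "v \<in> Omega G p"
  shows "coeff v (xs @ [x, m, y] @ ys) = 0"
proof (rule ccontr)
  let ?u = "xs @ [x, m, y] @ ys" and ?w = "xs @ [x, y] @ ys" and ?n = "length xs"
  assume nz: "coeff v ?u \<noteq> 0"
  have keys: "Poly_Mapping.keys v \<subseteq> allowed_paths G p"
    using v by (simp add: Omega_def allowed_chains_iff)
  with nz have u: "?u \<in> allowed_paths G p" by (auto simp: in_keys_iff)
  then have p: "p = Suc (p - 1)" by (auto simp: allowed_paths_def)
  have "boundary v \<in> allowed_chains G (p - 1)"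
    using v p by (cases p) (auto simp: Omega_def)
  moreover have "?w \<notin> allowed_paths G (p - 1)"
    using xy(2) by (auto simp: allowed_paths_def successively_append_iff)
  ultimately have zero: "coeff (boundary v) ?w = 0"
    by (auto simp: allowed_chains_iff in_keys_iff)
  have regular: "regular ?w"
  proof -
    have "successively (\<noteq>) ?u"
      using u no_loop by (auto simp: allowed_paths_def elim!: successively_mono)
    then show ?thesis
      using xy(1) by (auto simp: regular_def successively_append_iff)
  qed
  have filler: "u' = ?u \<and> q = Suc ?n"
    if u': "u' \<in> allowed_paths G p" and q: "q < length u'" and w: "omit q u' = ?w" for u' q
  proof -
    have len: "length u' = Suc (length ?w)"
      using u u' by (auto simp: allowed_paths_def)
    have n: "omit q u' ! ?n = x" "omit q u' ! Suc ?n = y"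
      unfolding w by (simp_all add: nth_append)
    then have x: "(if ?n < q then u' ! ?n else u' ! Suc ?n) = x"
      and y: "(if Suc ?n < q then u' ! Suc ?n else u' ! Suc (Suc ?n)) = y"
      using len q by (simp_all add: nth_omit)
    note edges = allowed_path_edge[OF u', of ?n] allowed_path_edge[OF u', of "Suc ?n"]
    (* For any other q, the edge xy would occur in u'. *)
    have qn: "q = Suc ?n"
      using x y edges xy(2) len by (auto split: if_splits)
    then have "u' ! Suc ?n = m"
      using x y edges len by (auto intro: unique)
    moreover have "take q u' = take q ?w" "drop (Suc q) u' = drop q ?w"
      unfolding w[symmetric] using q by (auto simp: omit_def min_def)
    then have "take q u' = xs @ [x]" "drop (Suc q) u' = y # ys"
      by (simp_all add: qn)
    ultimately show ?thesis
      using id_take_nth_drop[OF q] qn by simp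
  qed
  have omit_u: "omit (Suc ?n) ?u = ?w" by (simp add: omit_def)
  have "{q. q < length ?u \<and> omit q ?u = ?w} = {Suc ?n}"
    using filler[OF u] omit_u by auto
  then have "coeff (elem_boundary ?u) ?w = ((-1) ^ Suc ?n :: 'b)"
    using regular by (simp add: coeff_elem_boundary)
  moreover have "coeff (boundary v) ?w = coeff v ?u * coeff (elem_boundary ?u) ?w"
    using filler keys by (intro coeff_boundary_single) auto
  ultimately show False using zero nz by simp
qed

text \<open>
  This puts the 1-boundaries among the 1-cycles, so that the dimension of the homology in degree 1 is a
  difference of dimensions. For a path \<open>xyx\<close> the irregular face \<open>xx\<close> is dropped, but its boundary
  \<open>x - x\<close> would vanish anyway.
\<close>

lemma boundary_boundary_Omega_2:
  assumes no_loop: "\<And>z. \<not> edge G z z" and v: "v \<in> Omega G 2"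
  shows "boundary (boundary v) = 0"
proof -
  have "boundary (boundary (elem w :: ('a, 'b) chain)) = 0" if "w \<in> Poly_Mapping.keys v" for w
  proof -
    have w: "w \<in> allowed_paths G 2"
      using v that by (auto simp: Omega_def allowed_chains_iff)
    then obtain x y z where "w = [x, y, z]"
      by (auto simp: allowed_paths_def numeral_2_eq_2 length_Suc_conv)
    with w no_loop show ?thesis
      by (intro boundary_boundary_3[of x y z, folded \<open>w = _\<close>]) (auto simp: allowed_paths_def)
  qed
  then have "boundary (boundary (\<Sum>w\<in>Poly_Mapping.keys v. chain_scale (coeff v w) (elem w))) = 0"
    by (simp add: boundary.sum boundary.scale)
  then show ?thesis
    using chain_eq_sum_elem[of "Poly_Mapping.keys v" v] by simp
qed

lemma allowed_chains_subset_span: "allowed_chains G p \<subseteq> chain.span (elem ` allowed_paths G p)"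
  by (simp add: allowed_chains_def)

section \<open>Homology as cycles modulo boundaries\<close>

lemma dim_H_eq:
  assumes fin: "finite (pverts G)"
    and sub: "boundaries G p \<subseteq> (cycles G p :: ('v, 'k::field) chain set)"
  shows "dim_H TYPE('k) G p =
    chain.dim (cycles G p :: ('v, 'k) chain set) - chain.dim (boundaries G p :: ('v, 'k) chain set)"
  unfolding dim_H_def path_homology_def
proof (rule chain.dim_quotient_space[OF subspace_cycles subspace_boundaries sub])
  show "cycles G p \<subseteq> chain.span (elem ` allowed_paths G p)"
    using allowed_chains_subset_span by (auto simp: cycles_def Omega_def)
  show "finite (elem ` allowed_paths G p)"
    using finite_allowed_paths[OF fin] by simp
qed

lemma boundaries_0_subset_cycles: "boundaries G 0 \<subseteq> cycles G 0"
  using boundaries_subset_allowed by (auto simp: cycles_0 Omega_0)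

lemma boundaries_1_subset_cycles:
  assumes "\<And>z. \<not> edge G z z"
  shows "boundaries G 1 \<subseteq> cycles G 1"
proof
  fix u assume u: "u \<in> boundaries G 1"
  then have "boundary u = 0"
    using boundary_boundary_Omega_2[OF assms]
    by (auto simp: boundaries_def numeral_2_eq_2)
  moreover have "u \<in> allowed_chains G 1"
    using u boundaries_subset_allowed by blast
  ultimately show "u \<in> cycles G 1"
    by (simp add: cycles_def Omega_def chain.subspace_0[OF subspace_allowed_chains])
qed

text \<open>
  A space of chains for the larger digraph will be compared with one for the smaller digraph in this
  way: vanishing of one coefficient singles out the smaller space, and the witness \<open>t\<close> spans a
  complement.
\<close>

lemma dim_coeff_zero:
  fixes T :: "('v, 'k::field) chain set"
  assumes T: "chain.subspace T" and fin: "T \<subseteq> allowed_chains G p" "finite (pverts G)"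
    and t: "t \<in> T" "coeff t w = 1"
  shows "chain.dim T = chain.dim {v \<in> T. coeff v w = 0} + 1"
proof (rule chain.dim_adjoin)
  show "chain.subspace {v \<in> T. coeff v w = 0}"
    using T by (simp add: chain.subspace_def lookup_add)
  show "{v \<in> T. coeff v w = 0} \<subseteq> chain.span (elem ` allowed_paths G p)"
    using fin(1) allowed_chains_subset_span by blast
  show "finite (elem ` allowed_paths G p)"
    using finite_allowed_paths[OF fin(2)] by simp
  show "t \<notin> {v \<in> T. coeff v w = 0}" using t by simp
  show "T = {s + chain_scale r t | s r. s \<in> {v \<in> T. coeff v w = 0}}"
  proof (intro equalityI subsetI)
    fix v assume "v \<in> T"
    then have "v - chain_scale (coeff v w) t \<in> {v \<in> T. coeff v w = 0}"
      using T t by (auto simp: lookup_minus intro: chain.subspace_diff chain.subspace_scale)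
    moreover have "v = (v - chain_scale (coeff v w) t) + chain_scale (coeff v w) t"
      by simp
    ultimately show "v \<in> {s + chain_scale r t | s r. s \<in> {v \<in> T. coeff v w = 0}}"
      by blast
  qed (use T t in \<open>auto intro: chain.subspace_add chain.subspace_scale\<close>)
qed

section \<open>Deleting a vertex with one incoming and one outgoing edge\<close>

locale transit_vertex =
  fixes G H :: "'v pair_pre_digraph" and a b c :: 'v
  assumes finite_verts: "finite (pverts G)"
    and edge_verts: "edge G x y \<Longrightarrow> x \<in> pverts G \<and> y \<in> pverts G"
    and no_loop: "\<not> edge G x x"
    and a_vert: "a \<in> pverts G"
    and edge_from_a: "edge G a y \<longleftrightarrow> y = b"
    and edge_to_a: "edge G x a \<longleftrightarrow> x = c"
    and b_neq_c: "b \<noteq> c"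
    and verts_H: "pverts H = pverts G - {a}"
    and edge_H: "edge H x y \<longleftrightarrow> edge G x y \<and> x \<noteq> a \<and> y \<noteq> a"
begin

lemma a_neq: "a \<noteq> b" "a \<noteq> c"
  using no_loop edge_from_a edge_to_a by auto

lemma verts: "b \<in> pverts G" "c \<in> pverts G" "b \<in> pverts H" "c \<in> pverts H"
  using edge_verts[of a b] edge_verts[of c a] a_neq edge_from_a edge_to_a by (auto simp: verts_H)

lemma no_loop_H: "\<not> edge H x x"
  by (simp add: edge_H no_loop)

lemma finite_verts_H: "finite (pverts H)"
  by (simp add: verts_H finite_verts)

lemma allowed_paths_H: "allowed_paths H p = {w \<in> allowed_paths G p. a \<notin> set w}"
proof -
  have "successively (edge H) w \<longleftrightarrow> successively (edge G) w" if "a \<notin> set w" for w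
    using that by (intro successively_cong) (auto simp: edge_H)
  then show ?thesis by (auto simp: allowed_paths_def verts_H)
qed

lemma allowed_chains_H:
  "allowed_chains H p = {v \<in> allowed_chains G p. \<forall>w\<in>Poly_Mapping.keys v. a \<notin> set w}"
  by (auto simp: allowed_chains_iff allowed_paths_H)

lemma boundary_avoids:
  assumes "\<forall>w\<in>Poly_Mapping.keys v. a \<notin> set w"
  shows "\<forall>w\<in>Poly_Mapping.keys (boundary v). a \<notin> set w"
  using assms set_omit by (metis keys_boundaryE subsetD)

lemma Omega_H: "Omega H p = {v \<in> Omega G p. \<forall>w\<in>Poly_Mapping.keys v. a \<notin> set w}"
  using boundary_avoids by (cases p) (auto simp: Omega_def allowed_chains_H)

lemma cycles_H: "cycles H p = {v \<in> cycles G p. \<forall>w\<in>Poly_Mapping.keys v. a \<notin> set w}"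
  by (auto simp: cycles_def Omega_H)

text \<open>
  The vertex \<open>c\<close> is the only one between any \<open>x\<close> and \<open>a\<close>, and \<open>b\<close> the only one between \<open>a\<close> and any
  \<open>y\<close>. Here \<open>b \<noteq> c\<close> ensures \<open>x \<noteq> a\<close> and \<open>a \<noteq> y\<close>, so that \<open>coeff_Omega_unique_filler\<close> applies:
  nothing precedes \<open>c\<close> and nothing follows \<open>b\<close>.
\<close>

lemma Omega_through_a:
  assumes v: "v \<in> Omega G p" and p: "p \<ge> 2"
    and w: "w \<in> Poly_Mapping.keys v" "a \<in> set w"
  shows "w = [c, a, b]"
proof -
  have allowed: "w \<in> allowed_paths G p"
    using v w by (auto simp: Omega_def allowed_chains_iff)
  then have len: "length w \<ge> 3" and succ: "successively (edge G) w"
    using p by (auto simp: allowed_paths_def)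
  obtain xs ys where w_eq: "w = xs @ a # ys"
    using w(2) by (auto dest: split_list)
  have ys: "ys \<in> {[], [b]}"
  proof (cases ys)
    case ys: (Cons y ys1)
    have "successively (edge G) (xs @ [a, y] @ ys1)" using succ by (simp add: w_eq ys)
    then have y: "y = b" by (auto simp: successively_append_iff edge_from_a)
    show ?thesis
    proof (cases ys1)
      case ys1: (Cons z ys2)
      have w_eq': "w = xs @ [a, b, z] @ ys2" by (simp add: w_eq ys ys1 y)
      have "edge G b z" using succ unfolding w_eq' by (auto simp: successively_append_iff)
      then have "a \<noteq> z" "\<not> edge G a z"
        using b_neq_c no_loop edge_to_a[of b] edge_from_a[of z] by auto
      then have "coeff v w = 0"
        unfolding w_eq' using no_loop v
        by (intro coeff_Omega_unique_filler) (auto simp: edge_from_a)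
      then show ?thesis using w(1) by (simp add: in_keys_iff)
    qed (use ys y in simp)
  qed simp
  have xs: "xs \<in> {[], [c]}"
  proof (cases xs rule: rev_cases)
    case xs: (snoc xs1 x)
    have "successively (edge G) (xs1 @ [x, a] @ ys)" using succ by (simp add: w_eq xs)
    then have x: "x = c" by (auto simp: successively_append_iff edge_to_a)
    show ?thesis
    proof (cases xs1 rule: rev_cases)
      case xs1: (snoc xs2 z)
      have w_eq': "w = xs2 @ [z, c, a] @ ys" by (simp add: w_eq xs xs1 x)
      have "edge G z c" using succ unfolding w_eq' by (auto simp: successively_append_iff)
      then have "z \<noteq> a" "\<not> edge G z a"
        using b_neq_c no_loop edge_from_a[of c] edge_to_a[of z] by auto
      then have "coeff v w = 0"
        unfolding w_eq' using no_loop v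
        by (intro coeff_Omega_unique_filler) (auto simp: edge_to_a)
      then show ?thesis using w(1) by (simp add: in_keys_iff)
    qed (use xs x in simp)
  qed simp
  show ?thesis using xs ys len by (auto simp: w_eq)
qed

lemma Omega_eq_if_ge_3:
  assumes "p \<ge> 3"
  shows "Omega G p = Omega H p"
proof -
  have "a \<notin> set w" if "v \<in> Omega G p" "w \<in> Poly_Mapping.keys v"
    for v :: "('v, 'k::field) chain" and w
  proof
    assume "a \<in> set w"
    then have "w = [c, a, b]" using Omega_through_a that assms by fastforce
    moreover have "length w = Suc p"
      using that by (auto simp: Omega_def allowed_chains_iff allowed_paths_def)
    ultimately show False using assms by simp
  qed
  then show ?thesis by (auto simp: Omega_H)
qed

lemma coeff_avoids:
  assumes "\<forall>w\<in>Poly_Mapping.keys v. a \<notin> set w" and "a \<in> set u"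
  shows "coeff v u = 0"
  using assms by (metis in_keys_iff)

lemma Omega_2_H: "Omega H 2 = {v \<in> Omega G 2. coeff v [c, a, b] = 0}"
proof (intro equalityI subsetI)
  fix v assume "v \<in> {v \<in> Omega G 2. coeff v [c, a, b] = 0}"
  then have v: "v \<in> Omega G 2" "[c, a, b] \<notin> Poly_Mapping.keys v"
    by (simp_all add: in_keys_iff)
  have "a \<notin> set w" if "w \<in> Poly_Mapping.keys v" for w
    using Omega_through_a[OF v(1) order_refl that] that v(2) by blast
  then show "v \<in> Omega H 2" using v(1) by (simp add: Omega_H)
qed (auto simp: Omega_H intro: coeff_avoids)

text \<open>
  Any other path in \<open>v\<close> avoids \<open>a\<close>, and so do the paths in its boundary. In particular, \<open>[c, a, b]\<close>
  does not occur in 2-cycles.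
\<close>

lemma coeff_ab_boundary:
  assumes "v \<in> Omega G 2"
  shows "coeff (boundary v) [a, b] = coeff v [c, a, b]"
proof -
  have "coeff (boundary v) [a, b] = coeff v [c, a, b] * coeff (elem_boundary [c, a, b]) [a, b]"
  proof (rule coeff_boundary_single)
    fix w assume "w \<in> Poly_Mapping.keys v" "w \<noteq> [c, a, b]"
    then have "a \<notin> set w" using Omega_through_a assms by blast
    then have "[a, b] \<noteq> omit q w" for q
      using set_omit[of q w] by (metis list.set_intros(1) subsetD)
    then show "[a, b] \<notin> {omit q w | q. q < length w}" by blast
  qed
  then show ?thesis
    using a_neq b_neq_c by (simp add: elem_boundary_3 coeff_elem lookup_add lookup_minus)
qed

lemma cycles_eq_if_ge_2:
  assumes "p \<ge> 2"
  shows "cycles G p = (cycles H p :: ('v, 'k::field) chain set)"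
proof (cases "p = 2")
  case True
  have "coeff v [c, a, b] = 0" if "v \<in> Omega G 2" "boundary v = 0" for v :: "('v, 'k) chain"
    using coeff_ab_boundary[OF that(1)] that(2) by simp
  with True show ?thesis by (auto simp: cycles_def Omega_2_H)
next
  case False
  then show ?thesis using assms by (simp add: cycles_def Omega_eq_if_ge_3)
qed

lemma path_homology_eq_if_ge_2:
  assumes "p \<ge> 2"
  shows "path_homology G p = (path_homology H p :: ('k::field, ('v, 'k) chain set) module)"
  using assms by (simp add: path_homology_def cycles_eq_if_ge_2 boundaries_def Omega_eq_if_ge_3)


end

section \<open>Components and homology in degree 0\<close>

lemma same_component_iff_reachable:
  assumes "\<And>x y. edge G x y \<Longrightarrow> x \<in> pverts G \<and> y \<in> pverts G"
  shows "same_component G u v \<longleftrightarrow> u \<rightarrow>\<^sup>*\<^bsub>with_proj (mk_symmetric (with_proj G))\<^esub> v"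
proof -
  let ?S = "mk_symmetric (with_proj G)"
  interpret G: pair_wf_digraph G
    using assms by unfold_locales (auto simp: edge_def)
  interpret S: pair_wf_digraph ?S by (rule G.wellformed_mk_symmetric)
  have sym: "symmetric (with_proj ?S)" by (rule symmetric_mk_symmetric)
  show ?thesis
  proof
    assume "same_component G u v"
    then show "u \<rightarrow>\<^sup>*\<^bsub>with_proj ?S\<^esub> v"
      by (auto simp: same_component_def connected_components_def S.sccs_verts_def)
  next
    assume uv: "u \<rightarrow>\<^sup>*\<^bsub>with_proj ?S\<^esub> v"
    then have "v \<rightarrow>\<^sup>*\<^bsub>with_proj ?S\<^esub> u" by (rule symmetric_reachable[OF sym])
    with uv have "v \<in> S.scc_of u" by (simp add: S.scc_of_def)
    moreover have "u \<in> verts (with_proj ?S)" using uv by (rule reachable_in_vertsE)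
    then have u: "u \<in> pverts ?S" by simp
    have "u \<in> S.scc_of u" using u by (rule S.in_scc_of_self)
    moreover have "S.scc_of u \<in> S.sccs_verts" using u by (rule S.scc_of_in_sccs_verts)
    ultimately show "same_component G u v"
      unfolding same_component_def connected_components_def by blast
  qed
qed

lemma Omega_1: "Omega G 1 = allowed_chains G 1"
proof -
  have "boundary v \<in> allowed_chains G 0" if v: "v \<in> allowed_chains G 1" for v :: "('a, 'b) chain"
    unfolding boundary_def
  proof (intro chain.subspace_sum chain.subspace_scale subspace_allowed_chains)
    fix w assume "w \<in> Poly_Mapping.keys v"
    then have w: "w \<in> allowed_paths G 1" using v by (auto simp: allowed_chains_iff)
    then obtain x y where "w = [x, y]"
      by (auto simp: allowed_paths_def numeral_2_eq_2 length_Suc_conv)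
    with w show "elem_boundary w \<in> allowed_chains G 0"
      unfolding \<open>w = _\<close> elem_boundary_2
      by (intro chain.subspace_diff subspace_allowed_chains)
        (auto simp: elem_in_allowed_chains allowed_paths_def)
  qed
  then show ?thesis by (auto simp: Omega_def)
qed

lemma boundaries_0:
  "boundaries G 0 =
    chain.span {elem [y] - elem [x] | x y. edge G x y \<and> x \<in> pverts G \<and> y \<in> pverts G}"
proof -
  have "allowed_paths G 1 = {[x, y] | x y. edge G x y \<and> x \<in> pverts G \<and> y \<in> pverts G}"
    by (auto simp: allowed_paths_def numeral_2_eq_2 length_Suc_conv)
  then have "(boundary :: ('a, 'b) chain \<Rightarrow> _) ` elem ` allowed_paths G 1 =
      {elem [y] - elem [x] | x y. edge G x y \<and> x \<in> pverts G \<and> y \<in> pverts G}"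
    by (force simp: image_iff boundary_elem elem_boundary_2)
  then show ?thesis
    unfolding boundaries_def One_nat_def[symmetric] Omega_1 allowed_chains_def
      boundary.span_image[symmetric] by simp
qed

text \<open>
  Along an undirected walk from \<open>u\<close> to \<open>v\<close> the boundaries of its edges, with suitable signs, add up to
  \<open>u - v\<close>. Conversely, the sum of the coefficients over the component of \<open>u\<close> is a linear functional
  that vanishes on the boundary of every edge; on \<open>u - v\<close> it vanishes only if \<open>v\<close> is in that component.
\<close>

lemma same_component_iff_homologous:
  fixes G :: "'v pair_pre_digraph"
  assumes fin: "finite (pverts G)"
    and edge_verts: "\<And>x y. edge G x y \<Longrightarrow> x \<in> pverts G \<and> y \<in> pverts G"
    and u: "u \<in> pverts G" and v: "v \<in> pverts G"
  shows "same_component G u v \<longleftrightarrow> (elem [u] - elem [v] :: ('v, 'k::field) chain) \<in> boundaries G 0"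
proof -
  let ?S = "mk_symmetric (with_proj G)"
  let ?B = "boundaries G 0 :: ('v, 'k) chain set"
  interpret G: pair_wf_digraph G
    using edge_verts by unfold_locales (auto simp: edge_def)
  interpret S: pair_wf_digraph ?S by (rule G.wellformed_mk_symmetric)
  have adj: "(x, y) \<in> parcs ?S \<longleftrightarrow> edge G x y \<or> edge G y x" for x y
    by (auto simp: parcs_mk_symmetric edge_def Bex_def split_paired_Ex)
  have B: "chain.subspace ?B" by (rule subspace_boundaries)
  have "same_component G u v \<longleftrightarrow> u \<rightarrow>\<^sup>*\<^bsub>with_proj ?S\<^esub> v"
    by (rule same_component_iff_reachable) (rule edge_verts)
  also have "\<dots> \<longleftrightarrow> (elem [u] - elem [v] :: ('v, 'k) chain) \<in> ?B"
  proof
    assume "u \<rightarrow>\<^sup>*\<^bsub>with_proj ?S\<^esub> v"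
    then show "(elem [u] - elem [v] :: ('v, 'k) chain) \<in> ?B"
    proof (induction rule: S.reachable_induct)
      case base
      show ?case using chain.subspace_0[OF B] by simp
    next
      case (step x y)
      have edgeB: "(elem [y'] - elem [x'] :: ('v, 'k) chain) \<in> ?B" if "edge G x' y'" for x' y'
        using that edge_verts by (auto simp: boundaries_0 intro!: chain.span_base)
      have "(elem [x] - elem [y] :: ('v, 'k) chain) \<in> ?B"
        using step(2)[unfolded with_proj_simps arcs_ends_conv adj]
      proof
        assume "edge G x y"
        then have "- (elem [y] - elem [x] :: ('v, 'k) chain) \<in> ?B"
          by (rule chain.subspace_neg[OF B edgeB])
        then show ?thesis by simp
      qed (rule edgeB)
      then have "(elem [u] - elem [x]) + (elem [x] - elem [y] :: ('v, 'k) chain) \<in> ?B"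
        by (rule chain.subspace_add[OF B step.IH])
      then show ?case by simp
    qed
  next
    assume uv: "(elem [u] - elem [v] :: ('v, 'k) chain) \<in> ?B"
    define C where "C = {x \<in> pverts G. u \<rightarrow>\<^sup>*\<^bsub>with_proj ?S\<^esub> x}"
    define K where "K = {w :: ('v, 'k) chain. (\<Sum>x\<in>C. coeff w [x]) = 0}"
    have finC: "finite C" using fin by (simp add: C_def)
    have sum_elem: "(\<Sum>x\<in>C. coeff (elem [y] :: ('v, 'k) chain) [x]) = (if y \<in> C then 1 else 0)" for y
      using finC by (simp add: coeff_elem)
    have "chain.subspace K"
      unfolding chain.subspace_def K_def
      by (simp add: lookup_add sum.distrib flip: sum_distrib_left)
    moreover have "elem [y] - elem [x] \<in> K" if "edge G x y" for x y
    proof -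
      have "x \<in> C \<longleftrightarrow> y \<in> C"
        using that edge_verts[OF that] adj[of x y] adj[of y x] S.reachable_adj_trans[of u]
        by (auto simp: C_def)
      then show ?thesis by (simp add: K_def lookup_minus sum_subtractf sum_elem)
    qed
    ultimately have "?B \<subseteq> K"
      unfolding boundaries_0 by (intro chain.span_minimal) auto
    with uv have "(\<Sum>x\<in>C. coeff (elem [u] - elem [v] :: ('v, 'k) chain) [x]) = 0"
      by (auto simp: K_def)
    moreover have "u \<in> C" using u by (auto simp: C_def)
    ultimately have "v \<in> C"
      by (simp add: lookup_minus sum_subtractf sum_elem split: if_splits)
    then show "u \<rightarrow>\<^sup>*\<^bsub>with_proj ?S\<^esub> v" by (simp add: C_def)
  qed  finally show ?thesis .
qed

section \<open>Euler characteristics of digraphs with the same higher homology\<close>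

lemma dim_H_eq_0:
  fixes G :: "'v pair_pre_digraph"
  assumes trivial: "carrier (path_homology G p :: ('k::field, ('v, 'k) chain set) module) =
      {\<zero>\<^bsub>(path_homology G p :: ('k, ('v, 'k) chain set) module)\<^esub>}"
  shows "dim_H TYPE('k) G p = 0"
proof -
  let ?H = "path_homology G p :: ('k, ('v, 'k) chain set) module"
  interpret Q: vectorspace "class_ring :: 'k ring" ?H
    unfolding path_homology_def
    by (rule chain.vectorspace_quotient_space[OF subspace_cycles subspace_boundaries])
  have "Q.basis {}"
    unfolding Q.basis_def
    using trivial by (auto simp: Q.lin_dep_def Q.finite_span Q.lincomb_def)
  then show ?thesis
    unfolding dim_H_def using Q.dim_basis[of "{}"] by simp
qed

lemma euler_char_diff:
  fixes G H :: "'v pair_pre_digraph"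
  assumes defined: "euler_char_defined TYPE('k::field) G"
    and eq: "\<And>p. p \<ge> 2 \<Longrightarrow> dim_H TYPE('k) G p = dim_H TYPE('k) H p"
  shows "euler_char TYPE('k) G - euler_char TYPE('k) H =
    (int (dim_H TYPE('k) G 0) - int (dim_H TYPE('k) H 0)) -
    (int (dim_H TYPE('k) G 1) - int (dim_H TYPE('k) H 1))"
proof -
  let ?f = "\<lambda>K p. (-1) ^ p * int (dim_H TYPE('k) K p)"
  obtain N where trivial: "\<forall>p\<ge>N. carrier (path_homology G p :: ('k, ('v, 'k) chain set) module) =
      {\<zero>\<^bsub>(path_homology G p :: ('k, ('v, 'k) chain set) module)\<^esub>}"
    using defined unfolding euler_char_defined_def by (rule exE)
  have N: "dim_H TYPE('k) G p = 0" if "p \<ge> N" for p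
    using trivial that by (intro dim_H_eq_0) simp
  define M where "M = max N 2"
  have zero: "dim_H TYPE('k) G p = 0 \<and> dim_H TYPE('k) H p = 0" if "p \<ge> M" for p
    using N[of p] eq[of p] that by (simp add: M_def)
  have euler: "euler_char TYPE('k) K = (\<Sum>p<M. ?f K p)" if "K \<in> {G, H}" for K
  proof -
    have "p < M" if "dim_H TYPE('k) K p \<noteq> 0" for p
      using that zero[of p] \<open>K \<in> {G, H}\<close> by (cases "p < M") auto
    then show ?thesis
      unfolding euler_char_def by (intro sum.mono_neutral_left) auto
  qed
  have "euler_char TYPE('k) G - euler_char TYPE('k) H = (\<Sum>p<M. ?f G p - ?f H p)"
    by (simp add: euler sum_subtractf)
  also have "\<dots> = (\<Sum>p<2. ?f G p - ?f H p)"
    by (rule sum.mono_neutral_right) (auto simp: M_def eq)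
  finally show ?thesis by (simp add: numeral_2_eq_2)
qed

section \<open>Comparison in degrees 0 and 1\<close>

(* Degrees are kept in the form 0, 1, 2, so that the facts about degree 1 apply as rewrite rules. *)
declare One_nat_def [simp del]

lemma boundaries_0_image: "boundaries G 0 = boundary ` Omega G 1"
  and boundaries_1_image: "boundaries G 1 = boundary ` Omega G 2"
  by (simp_all add: boundaries_def One_nat_def numeral_2_eq_2)

lemma Omega_2: "v \<in> Omega G 2 \<longleftrightarrow> v \<in> allowed_chains G 2 \<and> boundary v \<in> allowed_chains G 1"
  by (simp add: Omega_def One_nat_def numeral_2_eq_2)

lemma cycles_subset_allowed: "cycles G p \<subseteq> allowed_chains G p"
  by (auto simp: cycles_def Omega_def)

context transit_vertex
begin

lemma edge_verts_H: "edge H x y \<Longrightarrow> x \<in> pverts H \<and> y \<in> pverts H"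
  using edge_verts by (auto simp: edge_H verts_H)

lemma coeff_boundaries_H:
  assumes "v \<in> boundaries H p" and "a \<in> set w"
  shows "coeff v w = 0"
  using assms boundaries_subset_allowed[of H p]
  by (intro coeff_avoids) (auto simp: allowed_chains_H)

lemma dim_cycles_0:
  "chain.dim (cycles G 0 :: ('v, 'k::field) chain set) =
    chain.dim (cycles H 0 :: ('v, 'k) chain set) + 1"
proof -
  have only: "w = [a]" if "w \<in> allowed_paths G 0" "a \<in> set w" for w
    using that by (auto simp: allowed_paths_def length_Suc_conv)
  have "(\<forall>w\<in>Poly_Mapping.keys v. a \<notin> set w) \<longleftrightarrow> coeff v [a] = 0"
    if "v \<in> allowed_chains G 0" for v :: "('v, 'k) chain"
  proof
    assume coeff: "coeff v [a] = 0"
    show "\<forall>w\<in>Poly_Mapping.keys v. a \<notin> set w"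
    proof (intro ballI notI)
      fix w assume w: "w \<in> Poly_Mapping.keys v" "a \<in> set w"
      then have "w = [a]" using that only by (auto simp: allowed_chains_iff)
      then show False using w(1) coeff by (simp add: in_keys_iff)
    qed
  qed (simp add: coeff_avoids)
  then have "{v \<in> allowed_chains G 0. coeff v [a] = 0} = (allowed_chains H 0 :: ('v, 'k) chain set)"
    unfolding allowed_chains_H by blast
  moreover have "chain.dim (allowed_chains G 0 :: ('v, 'k) chain set) =
      chain.dim {v \<in> allowed_chains G 0 :: ('v, 'k) chain set. coeff v [a] = 0} + 1"
    using a_vert finite_verts
    by (intro dim_coeff_zero[where t = "elem [a]" and p = 0])
      (auto simp: subspace_allowed_chains elem_in_allowed_chains allowed_paths_def coeff_elem)
  ultimately show ?thesis by (simp add: cycles_0 Omega_0)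
qed

lemma Omega_1_decomp:
  fixes v :: "('v, 'k::field) chain"
  assumes "v \<in> Omega G 1"
  obtains u where "u \<in> Omega H 1"
    and "v = chain_scale (coeff v [c, a]) (elem [c, a]) + chain_scale (coeff v [a, b]) (elem [a, b]) + u"
proof
  let ?u = "v - chain_scale (coeff v [c, a]) (elem [c, a]) - chain_scale (coeff v [a, b]) (elem [a, b])"
  have "w \<in> {[c, a], [a, b]}" if "w \<in> allowed_paths G 1" "a \<in> set w" for w
    using that by (auto simp: allowed_paths_def length_Suc_conv numeral_2_eq_2 One_nat_def edge_from_a edge_to_a)
  moreover have "Poly_Mapping.keys v \<subseteq> allowed_paths G 1"
    using assms by (simp add: Omega_1 allowed_chains_iff)
  ultimately have "w \<in> allowed_paths G 1 \<and> a \<notin> set w" if "w \<in> Poly_Mapping.keys ?u" for w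
    using that a_neq by (fastforce simp: in_keys_iff lookup_minus coeff_elem split: if_splits)
  then show "?u \<in> Omega H 1"
    unfolding Omega_1 by (auto simp: allowed_chains_iff allowed_paths_H)
qed simp

text \<open>
  In degree 0 the coefficient of \<open>a\<close> detects boundaries of chains that do not run equally often through
  \<open>ca\<close> and \<open>ab\<close>; in particular, a 1-cycle leaves \<open>a\<close> as often as it enters it.
\<close>

lemma coeff_a_boundary:
  assumes "v \<in> Omega G 1"
  shows "coeff (boundary v) [a] = coeff v [c, a] - coeff v [a, b]"
proof -
  obtain u where u: "u \<in> Omega H 1"
    and v: "v = chain_scale (coeff v [c, a]) (elem [c, a]) + chain_scale (coeff v [a, b]) (elem [a, b]) + u"
    using assms by (rule Omega_1_decomp)
  have "boundary u \<in> boundaries H 0" using u by (simp add: boundaries_0_image)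
  then have "coeff (boundary u) [a] = 0" by (rule coeff_boundaries_H) simp
  moreover have "boundary v = chain_scale (coeff v [c, a]) (elem [a] - elem [c]) +
      chain_scale (coeff v [a, b]) (elem [b] - elem [a]) + boundary u"
    by (subst v) (simp add: boundary.add boundary.scale boundary_elem elem_boundary_2)
  ultimately show ?thesis
    using a_neq by (simp add: lookup_add lookup_minus coeff_elem)
qed

lemma boundary_ca_ab: "boundary (elem [c, a] + elem [a, b]) = elem [b] - elem [c]"
  by (simp add: boundary.add boundary_elem elem_boundary_2)

lemma boundary_bypass:
  "boundary (chain_scale r (elem [c, a] + elem [a, b]) + u) = chain_scale r (elem [b] - elem [c]) + boundary u"
  by (simp only: boundary.add[of _ u] boundary.scale boundary_ca_ab)

lemma elem_ca_ab: "elem [c, a] \<in> Omega G 1" "elem [a, b] \<in> Omega G 1"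
  using a_vert verts
  by (auto simp: Omega_1 elem_in_allowed_chains allowed_paths_def edge_from_a edge_to_a)

lemma Omega_H_subset: "Omega H p \<subseteq> Omega G p"
  by (auto simp: Omega_H)

text \<open>
  If \<open>a\<close> cancels in a boundary, then \<open>ca\<close> and \<open>ab\<close> occur with the same coefficient, and together they
  act like a single edge from \<open>c\<close> to \<open>b\<close>.
\<close>

lemma boundaries_0_avoiding_a:
  "{v \<in> boundaries G 0. coeff v [a] = 0} =
    {s + chain_scale r (elem [b] - elem [c]) | s r. s \<in> boundaries H 0}"
proof (intro equalityI subsetI)
  fix x assume "x \<in> {v \<in> boundaries G 0. coeff v [a] = 0}"
  then obtain v where v: "v \<in> Omega G 1" "x = boundary v" "coeff (boundary v) [a] = 0"
    by (auto simp: boundaries_0_image)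
  obtain u where u: "u \<in> Omega H 1"
    and v_eq: "v = chain_scale (coeff v [c, a]) (elem [c, a]) + chain_scale (coeff v [a, b]) (elem [a, b]) + u"
    using v(1) by (rule Omega_1_decomp)
  have eq: "coeff v [a, b] = coeff v [c, a]"
    using coeff_a_boundary[OF v(1)] v(3) by simp
  have "v = chain_scale (coeff v [c, a]) (elem [c, a] + elem [a, b]) + u"
    using v_eq unfolding eq by (simp add: chain.scale_right_distrib)
  then have "boundary v = boundary (chain_scale (coeff v [c, a]) (elem [c, a] + elem [a, b]) + u)"
    by (rule arg_cong)
  then have "x = boundary u + chain_scale (coeff v [c, a]) (elem [b] - elem [c])"
    unfolding v(2) boundary_bypass by (simp only: add.commute)
  moreover have "boundary u \<in> boundaries H 0" using u by (simp add: boundaries_0_image)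
  ultimately show "x \<in> {s + chain_scale r (elem [b] - elem [c]) | s r. s \<in> boundaries H 0}"
    by blast
next
  fix x assume "x \<in> {s + chain_scale r (elem [b] - elem [c]) | s r. s \<in> boundaries H 0}"
  then obtain s r where s: "s \<in> boundaries H 0" and x: "x = s + chain_scale r (elem [b] - elem [c])"
    by blast
  have "elem [b] - elem [c] \<in> boundaries G 0"
    unfolding boundary_ca_ab[symmetric] boundaries_0_image
    using elem_ca_ab by (auto intro!: imageI chain.subspace_add[OF subspace_Omega])
  moreover have "s \<in> boundaries G 0"
    using s Omega_H_subset by (auto simp: boundaries_0_image)
  ultimately have "x \<in> boundaries G 0"
    unfolding x by (intro chain.subspace_add chain.subspace_scale subspace_boundaries)
  moreover have "coeff x [a] = 0"
    using coeff_boundaries_H[OF s] a_neq by (simp add: x lookup_add lookup_minus coeff_elem)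
  ultimately show "x \<in> {v \<in> boundaries G 0. coeff v [a] = 0}" by simp
qed

text \<open>
  The chain \<open>a - c\<close> always contributes one dimension; the bypass \<open>b - c\<close> contributes another one unless
  it already is a boundary without \<open>a\<close>.
\<close>

lemma dim_boundaries_0:
  "chain.dim (boundaries G 0 :: ('v, 'k::field) chain set) =
    chain.dim (boundaries H 0 :: ('v, 'k) chain set) + (if same_component H b c then 1 else 2)"
proof -
  let ?K = "{v \<in> boundaries G 0 :: ('v, 'k) chain set. coeff v [a] = 0}"
  let ?x = "elem [b] - elem [c] :: ('v, 'k) chain"
  have "elem [a] - elem [c] = (boundary (elem [c, a]) :: ('v, 'k) chain)"
    by (simp add: boundary_elem elem_boundary_2)
  then have "elem [a] - elem [c] \<in> (boundaries G 0 :: ('v, 'k) chain set)"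
    by (simp only: boundaries_0_image imageI elem_ca_ab)
  then have G: "chain.dim (boundaries G 0 :: ('v, 'k) chain set) = chain.dim ?K + 1"
    using a_neq finite_verts
    by (intro dim_coeff_zero[where p = 0 and t = "elem [a] - elem [c]"])
      (auto simp: subspace_boundaries boundaries_subset_allowed lookup_minus coeff_elem)
  have iff: "same_component H b c \<longleftrightarrow> ?x \<in> boundaries H 0"
    using finite_verts_H edge_verts_H verts by (intro same_component_iff_homologous) auto
  show ?thesis
  proof (cases "same_component H b c")
    case True
    have "?K = boundaries H 0"
      unfolding boundaries_0_avoiding_a
    proof (intro equalityI subsetI)
      fix x :: "('v, 'k) chain" assume "x \<in> boundaries H 0"
      then have "x \<in> boundaries H 0 \<and> x = x + chain_scale 0 ?x" by simp
      then show "x \<in> {s + chain_scale r ?x | s r. s \<in> boundaries H 0}" by blast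
    qed (use True iff in \<open>auto intro!: chain.subspace_add chain.subspace_scale subspace_boundaries\<close>)
    with G True show ?thesis by simp
  next
    case False
    have "chain.dim ?K = chain.dim (boundaries H 0 :: ('v, 'k) chain set) + 1"
    proof (rule chain.dim_adjoin[OF subspace_boundaries])
      show "boundaries H 0 \<subseteq> chain.span (elem ` allowed_paths H 0)"
        using boundaries_subset_allowed allowed_chains_subset_span by blast
      show "finite (elem ` allowed_paths H 0)"
        using finite_allowed_paths[OF finite_verts_H] by simp
      show "?x \<notin> boundaries H 0" using False iff by simp
    qed (rule boundaries_0_avoiding_a)
    with G False show ?thesis by simp
  qed
qed

lemma coeff_cycle:
  assumes "v \<in> cycles G 1"
  shows "coeff v [a, b] = coeff v [c, a]"
  using coeff_a_boundary[of v] assms by (simp add: cycles_def)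

lemma cycles_1_H: "cycles H 1 = {v \<in> cycles G 1. coeff v [c, a] = 0}"
proof (intro equalityI subsetI)
  fix v assume v: "v \<in> {v \<in> cycles G 1. coeff v [c, a] = 0}"
  then have "v \<in> Omega G 1" by (simp add: cycles_def)
  then obtain u where "u \<in> Omega H 1"
    and "v = chain_scale (coeff v [c, a]) (elem [c, a]) + chain_scale (coeff v [a, b]) (elem [a, b]) + u"
    by (rule Omega_1_decomp)
  then show "v \<in> cycles H 1"
    using v coeff_cycle[of v] by (auto simp: cycles_def)
qed (auto simp: cycles_H intro: coeff_avoids)

text \<open>
  A 1-cycle running \<open>r\<close> times through \<open>ca\<close> and \<open>ab\<close> leaves in the rest of the digraph a chain with
  boundary \<open>- r (b - c)\<close>. With \<open>r \<noteq> 0\<close> this is possible exactly if \<open>b - c\<close> is a boundary there.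
\<close>

lemma dim_cycles_1:
  "chain.dim (cycles G 1 :: ('v, 'k::field) chain set) =
    chain.dim (cycles H 1 :: ('v, 'k) chain set) + (if same_component H b c then 1 else 0)"
proof -
  let ?x = "elem [b] - elem [c] :: ('v, 'k) chain"
  have iff: "same_component H b c \<longleftrightarrow> ?x \<in> boundaries H 0"
    using finite_verts_H edge_verts_H verts by (intro same_component_iff_homologous) auto
  show ?thesis
  proof (cases "same_component H b c")
    case True
    then obtain u where u: "u \<in> Omega H 1" "boundary u = ?x"
      using iff by (auto simp: boundaries_0_image)
    define z where "z = elem [c, a] + elem [a, b] - u"
    have "boundary z = 0"
      unfolding z_def boundary.diff boundary_ca_ab u(2) by simp
    moreover have "z \<in> Omega G 1"
      unfolding z_def using elem_ca_ab u Omega_H_subset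
      by (intro chain.subspace_diff chain.subspace_add subspace_Omega) auto
    ultimately have "z \<in> cycles G 1" by (simp add: cycles_def)
    moreover have "coeff u [c, a] = 0"
      using u(1) by (auto simp: Omega_H intro: coeff_avoids)
    then have "coeff z [c, a] = 1"
      using a_neq by (simp add: z_def lookup_add lookup_minus coeff_elem)
    ultimately show ?thesis
      unfolding cycles_1_H using True finite_verts
      by (subst dim_coeff_zero[where t = z and w = "[c, a]" and p = 1])
        (auto simp: subspace_cycles cycles_subset_allowed)
  next
    case False
    have "coeff v [c, a] = 0" if v: "v \<in> cycles G 1" for v :: "('v, 'k) chain"
    proof (rule ccontr)
      assume nz: "coeff v [c, a] \<noteq> 0"
      let ?r = "coeff v [c, a]"
      obtain u where u: "u \<in> Omega H 1"
        and "v = chain_scale ?r (elem [c, a]) + chain_scale (coeff v [a, b]) (elem [a, b]) + u"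
        using v by (auto simp: cycles_def elim: Omega_1_decomp)
      then have "v = chain_scale ?r (elem [c, a] + elem [a, b]) + u"
        using coeff_cycle[OF v] by (simp add: chain.scale_right_distrib)
      then have "boundary v = boundary (chain_scale ?r (elem [c, a] + elem [a, b]) + u)"
        by (rule arg_cong)
      then have "0 = chain_scale ?r ?x + boundary u"
        using v unfolding boundary_bypass by (simp add: cycles_def)
      then have "chain_scale ?r ?x = - boundary u"
        by (simp add: eq_neg_iff_add_eq_0)
      then have "chain_scale (inverse ?r) (chain_scale ?r ?x) = chain_scale (- inverse ?r) (boundary u)"
        by simp
      then have "?x = boundary (chain_scale (- inverse ?r) u)"
        using nz by (simp add: boundary.scale boundary.neg)
      moreover have "chain_scale (- inverse ?r) u \<in> Omega H 1"
        using u by (rule chain.subspace_scale[OF subspace_Omega])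
      ultimately have "?x \<in> boundaries H 0" by (simp add: boundaries_0_image)
      then show False using False iff by simp
    qed
    then have "cycles H 1 = (cycles G 1 :: ('v, 'k) chain set)"
      by (auto simp: cycles_1_H)
    then show ?thesis using False by simp
  qed
qed

text \<open>
  By \<open>coeff_ab_boundary\<close>, the boundaries that come from \<open>H\<close> are those without \<open>ab\<close>. It remains to
  decide whether some invariant chain contains \<open>cab\<close>. If it does, then \<open>cb\<close>, the face of \<open>cab\<close> that
  \<open>G\<close> may lack, must be an edge or be cancelled with the help of another vertex between \<open>c\<close> and \<open>b\<close>.
\<close>

lemma dim_boundaries_1:
  "chain.dim (boundaries G 1 :: ('v, 'k::field) chain set) =
    chain.dim (boundaries H 1 :: ('v, 'k) chain set) + (if edge H c b \<or> semi_edge H c b then 1 else 0)"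
proof -
  have B_H: "boundaries H 1 = {v \<in> boundaries G 1. coeff v [a, b] = 0}"
    by (auto simp: boundaries_1_image Omega_2_H coeff_ab_boundary)
  show ?thesis
  proof (cases "edge H c b \<or> semi_edge H c b")
    case True
    have allowed: "[c, a, b] \<in> allowed_paths G 2" "[a, b] \<in> allowed_paths G 1" "[c, a] \<in> allowed_paths G 1"
      using a_vert verts by (auto simp: allowed_paths_def edge_from_a edge_to_a)
    obtain f where f: "f \<in> Omega G 2" "coeff f [c, a, b] = (1 :: 'k)"
    proof (cases "edge H c b")
      case True
      then have "[c, b] \<in> allowed_paths G 1"
        using verts by (simp add: allowed_paths_def edge_H)
      then have "boundary (elem [c, a, b] :: ('v, 'k) chain) \<in> allowed_chains G 1"
        using a_neq b_neq_c allowed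
        by (simp add: boundary_elem elem_boundary_3 chain.subspace_diff chain.subspace_add
          subspace_allowed_chains elem_in_allowed_chains)
      then show ?thesis
        using allowed by (intro that[of "elem [c, a, b]"])
          (simp_all add: Omega_2 elem_in_allowed_chains coeff_elem)
    next
      case False
      with \<open>edge H c b \<or> semi_edge H c b\<close> obtain j where j: "edge G c j" "edge G j b" "j \<noteq> a"
        by (auto simp: semi_edge_def edge_H)
      then have j_allowed: "[c, j, b] \<in> allowed_paths G 2" "[c, j] \<in> allowed_paths G 1" "[j, b] \<in> allowed_paths G 1"
        using edge_verts verts by (auto simp: allowed_paths_def)
      have neq: "c \<noteq> j" "j \<noteq> b" using j no_loop by auto
      let ?f = "elem [c, a, b] - elem [c, j, b] :: ('v, 'k) chain"
      have "boundary ?f = elem [a, b] + elem [c, a] - (elem [j, b] + elem [c, j])"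
        using a_neq b_neq_c neq by (simp add: boundary.diff boundary_elem elem_boundary_3)
      also have "\<dots> \<in> allowed_chains G 1"
        using allowed j_allowed
        by (simp add: chain.subspace_diff chain.subspace_add subspace_allowed_chains elem_in_allowed_chains)
      finally show ?thesis
        using allowed j_allowed j(3) by (intro that[of ?f])
          (simp_all add: Omega_2 elem_in_allowed_chains coeff_elem lookup_minus
            chain.subspace_diff subspace_allowed_chains)
    qed
    have "boundary f \<in> boundaries G 1" "coeff (boundary f) [a, b] = 1"
      using f by (auto simp: boundaries_1_image coeff_ab_boundary)
    then show ?thesis
      unfolding B_H using True finite_verts
      by (subst dim_coeff_zero[where t = "boundary f" and w = "[a, b]" and p = 1])
        (auto simp: subspace_boundaries boundaries_subset_allowed)
  next
    case False
    have not_edge: "\<not> edge G c b" using False a_neq by (simp add: edge_H)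
    moreover have "z = a" if "edge G c z" "edge G z b" for z
      using False that a_neq b_neq_c verts edge_verts[OF that(1)] not_edge
      by (auto simp: semi_edge_def edge_H verts_H)
    ultimately have "coeff v ([] @ [c, a, b] @ []) = 0" if "v \<in> Omega G 2" for v :: "('v, 'k) chain"
      using that no_loop b_neq_c by (intro coeff_Omega_unique_filler) auto
    then have "Omega H 2 = (Omega G 2 :: ('v, 'k) chain set)"
      by (auto simp: Omega_2_H)
    then show ?thesis
      using False by (simp add: boundaries_1_image)
  qed
qed

lemma same_component_if_edge_or_semi_edge:
  assumes "edge H c b \<or> semi_edge H c b"
  shows "same_component H b c"
proof -
  (* Components are independent of the coefficient field; the rationals serve as a witness. *)
  have B: "(elem [y] - elem [x] :: ('v, rat) chain) \<in> boundaries H 0" if "edge H x y" for x y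
    using that edge_verts_H by (auto simp: boundaries_0 intro!: chain.span_base)
  have "(elem [b] - elem [c] :: ('v, rat) chain) \<in> boundaries H 0"
  proof (cases "edge H c b")
    case True
    then show ?thesis by (rule B)
  next
    case False
    then obtain j where "edge H c j" "edge H j b"
      using assms by (auto simp: semi_edge_def)
    then have "(elem [b] - elem [j]) + (elem [j] - elem [c] :: ('v, rat) chain) \<in> boundaries H 0"
      by (intro chain.subspace_add subspace_boundaries B)
    then show ?thesis by simp
  qed
  then show ?thesis
    using finite_verts_H edge_verts_H verts
    by (subst same_component_iff_homologous[where 'k = rat]) auto
qed

lemma dim_H_changes:
  shows "\<And>p. p \<ge> 2 \<Longrightarrow> dim_H TYPE('k::field) G p = dim_H TYPE('k) H p"
    and "int (dim_H TYPE('k) G 1) = int (dim_H TYPE('k) H 1) +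
      (if same_component H b c \<and> \<not> edge H c b \<and> \<not> semi_edge H c b then 1 else 0)"
    and "int (dim_H TYPE('k) G 0) = int (dim_H TYPE('k) H 0) - (if same_component H b c then 0 else 1)"
proof -
  show "dim_H TYPE('k) G p = dim_H TYPE('k) H p" if "p \<ge> 2" for p
    using that by (simp add: dim_H_def path_homology_eq_if_ge_2)
  have le: "chain.dim (boundaries K p :: ('v, 'k) chain set) \<le> chain.dim (cycles K p :: ('v, 'k) chain set)"
    if "K \<in> {G, H}" "boundaries K p \<subseteq> (cycles K p :: ('v, 'k) chain set)" for K p
  proof (rule chain.dim_subset_fin[OF that(2)])
    show "cycles K p \<subseteq> chain.span (elem ` allowed_paths K p)"
      using cycles_subset_allowed allowed_chains_subset_span by blast
    show "finite (elem ` allowed_paths K p)"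
      using that(1) finite_verts finite_verts_H finite_allowed_paths by blast
  qed
  have sub: "boundaries K 0 \<subseteq> (cycles K 0 :: ('v, 'k) chain set)"
    "boundaries K 1 \<subseteq> (cycles K 1 :: ('v, 'k) chain set)" if "K \<in> {G, H}" for K
    using that no_loop no_loop_H
    by (intro boundaries_0_subset_cycles, intro boundaries_1_subset_cycles) auto
  have dim: "int (dim_H TYPE('k) K p) =
      int (chain.dim (cycles K p :: ('v, 'k) chain set)) - int (chain.dim (boundaries K p :: ('v, 'k) chain set))"
    if "K \<in> {G, H}" "p \<in> {0, 1}" for K p
  proof -
    have "boundaries K p \<subseteq> (cycles K p :: ('v, 'k) chain set)"
      using that sub by blast
    moreover have "finite (pverts K)" using that(1) finite_verts finite_verts_H by blast
    ultimately show ?thesis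
      using le[OF that(1)] by (simp add: dim_H_eq of_nat_diff)
  qed
  show "int (dim_H TYPE('k) G 1) = int (dim_H TYPE('k) H 1) +
      (if same_component H b c \<and> \<not> edge H c b \<and> \<not> semi_edge H c b then 1 else 0)"
    using same_component_if_edge_or_semi_edge
    by (auto simp: dim dim_cycles_1 dim_boundaries_1)
  show "int (dim_H TYPE('k) G 0) = int (dim_H TYPE('k) H 0) - (if same_component H b c then 0 else 1)"
    by (simp add: dim dim_cycles_0 dim_boundaries_0)
qed

lemma euler_char_change:
  assumes "euler_char_defined TYPE('k::field) G \<or> euler_char_defined TYPE('k) H"
  shows "euler_char TYPE('k) G = euler_char TYPE('k) H -
    (if edge H c b \<or> semi_edge H c b then 0 else 1)"
proof -
  have "euler_char_defined TYPE('k) G"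
  proof (rule disjE[OF assms])
    assume "euler_char_defined TYPE('k) H"
    then obtain N where N: "\<forall>p\<ge>N. carrier (path_homology H p :: ('k, ('v, 'k) chain set) module) =
        {\<zero>\<^bsub>(path_homology H p :: ('k, ('v, 'k) chain set) module)\<^esub>}"
      unfolding euler_char_defined_def by (rule exE)
    have "\<forall>p\<ge>max N 2. carrier (path_homology G p :: ('k, ('v, 'k) chain set) module) =
        {\<zero>\<^bsub>(path_homology G p :: ('k, ('v, 'k) chain set) module)\<^esub>}"
      using N by (simp add: path_homology_eq_if_ge_2)
    then show ?thesis unfolding euler_char_defined_def by (rule exI)
  qed
  then have "euler_char TYPE('k) G - euler_char TYPE('k) H =
      (int (dim_H TYPE('k) G 0) - int (dim_H TYPE('k) H 0)) -
      (int (dim_H TYPE('k) G 1) - int (dim_H TYPE('k) H 1))"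
    by (rule euler_char_diff) (rule dim_H_changes)
  then show ?thesis
    using same_component_if_edge_or_semi_edge by (auto simp: dim_H_changes(2,3) split: if_splits)
qed

end

section \<open>The deletion theorem\<close>

theorem theorem5p7:
  fixes G G' :: "'v pair_pre_digraph" and a b c :: 'v
  assumes G: "pair_digraph G"
    and a: "a \<in> pverts G"
    and out: "out_arcs (with_proj G) a = {(a, b)}"
    and inc: "in_arcs (with_proj G) a = {(c, a)}"
    and bc: "b \<noteq> c"
    and G': "G' = \<lparr> pverts = pverts G - {a}, parcs = parcs G - {(a, b), (c, a)} \<rparr>"
  shows
    "(\<forall>p\<ge>2. dim_H TYPE('k::field_char_0) G p = dim_H TYPE('k) G' p) \<and>
     (edge G' c b \<or> semi_edge G' c b \<longrightarrow>
        (\<forall>p. dim_H TYPE('k) G p = dim_H TYPE('k) G' p) \<and>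
        (euler_char_defined TYPE('k) G \<or> euler_char_defined TYPE('k) G' \<longrightarrow>
           euler_char TYPE('k) G = euler_char TYPE('k) G')) \<and>
     (\<not> edge G' c b \<and> \<not> semi_edge G' c b \<and> same_component G' b c \<longrightarrow>
        dim_H TYPE('k) G 1 = dim_H TYPE('k) G' 1 + 1 \<and>
        dim_H TYPE('k) G 0 = dim_H TYPE('k) G' 0 \<and>
        (euler_char_defined TYPE('k) G \<or> euler_char_defined TYPE('k) G' \<longrightarrow>
           euler_char TYPE('k) G = euler_char TYPE('k) G' - 1)) \<and>
     (\<not> same_component G' b c \<longrightarrow>
        dim_H TYPE('k) G 1 = dim_H TYPE('k) G' 1 \<and>
        int (dim_H TYPE('k) G 0) = int (dim_H TYPE('k) G' 0) - 1 \<and>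
        (euler_char_defined TYPE('k) G \<or> euler_char_defined TYPE('k) G' \<longrightarrow>
           euler_char TYPE('k) G = euler_char TYPE('k) G' - 1))"
proof -
  interpret D: pair_digraph G by (rule G)
  have from_a: "edge G a y \<longleftrightarrow> y = b" for y
  proof -
    have "edge G a y \<longleftrightarrow> (a, y) \<in> out_arcs (with_proj G) a" by (simp add: edge_def)
    then show ?thesis by (simp add: out)
  qed
  have to_a: "edge G x a \<longleftrightarrow> x = c" for x
  proof -
    have "edge G x a \<longleftrightarrow> (x, a) \<in> in_arcs (with_proj G) a" by (simp add: edge_def)
    then show ?thesis by (simp add: inc)
  qed
  interpret transit_vertex G G' a b c
  proof
    show "edge G' x y \<longleftrightarrow> edge G x y \<and> x \<noteq> a \<and> y \<noteq> a" for x y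
      using from_a to_a by (auto simp: G' edge_def)
    show "\<not> edge G x x" for x
      using D.no_loops[of "(x, x)"] by (auto simp: edge_def)
    show "x \<in> pverts G \<and> y \<in> pverts G" if "edge G x y" for x y
      using that D.in_arcsD1 D.in_arcsD2 by (auto simp: edge_def)
  qed (use a bc from_a to_a in \<open>simp_all add: G'\<close>)
  note changes = dim_H_changes[where 'k = 'k]
  have "dim_H TYPE('k) G p = dim_H TYPE('k) G' p" if "edge G' c b \<or> semi_edge G' c b" for p
  proof -
    consider "p = 0" | "p = 1" | "p \<ge> 2" by linarith
    then show ?thesis
      using that changes same_component_if_edge_or_semi_edge by cases auto
  qed
  then show ?thesis
    using changes euler_char_change[where 'k = 'k] same_component_if_edge_or_semi_edge by auto
qed

end
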